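(* The class $\mathit{MS}$ of all disjunction-free multiplicity schemas is learnable in polynomial time and data from positive examples, i.e., in the learning setting $(\mathit{Tree},\mathit{MS},L)$, where the examples are unordered labeled trees and $L$ maps every schema $S$ to the set $L(S)$ of all trees satisfying $S$.
   Context: **Alphabet.** $\Sigma$ is a finite alphabet with a total order testable in constant time. The alphabet is given as part of the input, and polynomial bounds are uniform in $\Sigma$. **Unordered words.** An unordered word is a multiset of symbols, i.e., a function $w:\Sigma\to\mathbb{N}_0$. **Disjunction-free multiplicity expressions.** A multiplicity is an element of $\{*,+,?,0,1\}$, with $[\![*]\!]=\{0,1,2,\ldots\}$, $[\![+]\!]=\{1,2,\ldots\}$, $[\![?]\!]=\{0,1\}$, $[\![1]\!]=\{1\}$, $[\![0]\!]=\{0\}$. A disjunction-free multiplicity expression is $E=a_1^{M_1}\,\|\,\ldots\,\|\,a_k^{M_k}$, where the $a_i\in\Sigma$ are pairwise distinct symbols and the $M_i$ are multiplicities. Its language $L(E)$ is the set of unordered words $w$ such that $w(a_i)\in[\![M_i]\!]$ for all $1\le i\le k$ and $w(a)=0$ for every symbol $a$ not occurring in $E$. **Trees.** A tree $t=(N_t,\mathit{root}_t,\mathit{lab}_t,\mathit{child}_t)$ has a finite set of nodes $N_t$, a root $\mathit{root}_t\in N_t$, a labeling $\mathit{lab}_t:N_t\to\Sigma$, and an acyclic parent-child relation $\mathit{child}_t\subseteq N_t\times N_t$ in which every non-root node has exactly one predecessor. $\mathit{Tree}$ is the set of all finite trees; the size of a tree is its number of nodes. For $n\in N_t$, let $\mathit{ch}_t^n$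 be the unordered word with $\mathit{ch}_t^n(a)=|\{m\in N_t\mid (n,m)\in\mathit{child}_t,\ \mathit{lab}_t(m)=a\}|$. **Schemas.** A disjunction-free multiplicity schema (MS) is a pair $S=(\mathit{root}_S,R_S)$ with $\mathit{root}_S\in\Sigma$ and $R_S$ mapping each symbol of $\Sigma$ to a disjunction-free multiplicity expression. A tree $t$ satisfies $S$ if $\mathit{lab}_t(\mathit{root}_t)=\mathit{root}_S$ and $\mathit{ch}_t^n\in L(R_S(\mathit{lab}_t(n)))$ for every $n\in N_t$. $L(S)$ is the set of all trees satisfying $S$. **Learnability.** A learning setting is a tuple $(\mathcal{E},\mathcal{C},\mathcal{L})$ with a set $\mathcal{E}$ of examples, a class $\mathcal{C}$ of concepts, and a function $\mathcal{L}$ mapping each concept to a subset of $\mathcal{E}$. A sample is a finite nonempty set $D\subseteq\mathcal{E}$ (its size is the sum of the sizes of its examples); it is consistent with $c\in\mathcal{C}$ if $D\subseteq\mathcal{L}(c)$. A learning algorithm takes a sample and returns a concept in $\mathcal{C}$ or a special value null. Concepts $c,c'$ are equivalent if $\mathcal{L}(c)=\mathcal{L}(c')$. The class $\mathcal{C}$ is learnable in polynomial time and data in $(\mathcal{E},\mathcal{C},\mathcal{L})$ if there is a learning algorithm $\mathit{learner}$, running in time polynomial in the size of its input, such that: (1) Soundness: for every sample $D$, $\mathit{learner}(D)$ returns a concept consistent with $D$, or null if no such concept exists; (2) Completeness: for every $c\in\mathcal{C}$ there is a sample $\mathit{CS}_c$, whose cardinality (number of examples) is polynomially bounded by the size of $c$,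 such that for every sample $D$ with $\mathit{CS}_c\subseteq D\subseteq\mathcal{L}(c)$, $\mathit{learner}(D)$ returns a concept equivalent to $c$. *)

theory Defs
  imports "HOL-Library.FuncSet" "HOL-Computational_Algebra.Polynomial"
begin

section \<open>Unordered words and multiplicity expressions\<close>

type_synonym 'a uword = "'a \<Rightarrow> nat"

datatype mult = Star | Plus | Opt | One | Zero

fun mult_set :: "mult \<Rightarrow> nat set" where
  "mult_set Star = UNIV"
| "mult_set Plus = {1..}"
| "mult_set Opt = {0, 1}"
| "mult_set One = {1}"
| "mult_set Zero = {0}"

text \<open>The list \<open>[(a\<^sub>1, M\<^sub>1), \<dots>, (a\<^sub>k, M\<^sub>k)]\<close> stands for the expression
  \<open>a\<^sub>1^M\<^sub>1 \<parallel> \<dots> \<parallel> a\<^sub>k^M\<^sub>k\<close>; the empty list (\<open>k = 0\<close>) has only the empty word in its language.\<close>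

type_synonym 'a mexpr = "('a \<times> mult) list"

definition mexprs :: "'a set \<Rightarrow> 'a mexpr set" where
  "mexprs \<Sigma> = {E. distinct (map fst E) \<and> fst ` set E \<subseteq> \<Sigma>}"

definition mexpr_lang :: "'a mexpr \<Rightarrow> 'a uword set" where
  "mexpr_lang E = {w. (\<forall>(a, M) \<in> set E. w a \<in> mult_set M) \<and> (\<forall>a. a \<notin> fst ` set E \<longrightarrow> w a = 0)}"


section \<open>Trees and schemas\<close>

text \<open>Nodes are natural numbers, so up to isomorphism every finite tree is present. Labelings and
  rule maps are extensional functions (\<open>\<rightarrow>\<^sub>E\<close>): HOL equality then is equality of the tuples.\<close>

record 'a tree =
  tnodes :: "nat set"
  troot :: nat
  tlab :: "nat \<Rightarrow> 'a"
  tchild :: "(nat \<times> nat) set"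

definition trees :: "'a set \<Rightarrow> 'a tree set" where
  "trees \<Sigma> = {t. finite (tnodes t) \<and> troot t \<in> tnodes t \<and> tlab t \<in> tnodes t \<rightarrow>\<^sub>E \<Sigma> \<and>
     tchild t \<subseteq> tnodes t \<times> tnodes t \<and> acyclic (tchild t) \<and>
     (\<forall>n \<in> tnodes t - {troot t}. \<exists>!m. (m, n) \<in> tchild t)}"

definition tree_size :: "'a tree \<Rightarrow> nat" where
  "tree_size t = card (tnodes t)"

definition ch :: "'a tree \<Rightarrow> nat \<Rightarrow> 'a uword" where
  "ch t n a = card {m \<in> tnodes t. (n, m) \<in> tchild t \<and> tlab t m = a}"

record 'a schema =
  sroot :: 'a
  srule :: "'a \<Rightarrow> 'a mexpr"

definition schemas :: "'a set \<Rightarrow> 'a schema set" where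
  "schemas \<Sigma> = {S. sroot S \<in> \<Sigma> \<and> srule S \<in> \<Sigma> \<rightarrow>\<^sub>E mexprs \<Sigma>}"

definition schema_lang :: "'a set \<Rightarrow> 'a schema \<Rightarrow> 'a tree set" where
  "schema_lang \<Sigma> S = {t \<in> trees \<Sigma>. tlab t (troot t) = sroot S \<and>
     (\<forall>n \<in> tnodes t. ch t n \<in> mexpr_lang (srule S (tlab t n)))}"

text \<open>One unit for the root symbol, one for each left-hand side, one for each factor \<open>a^M\<close>.\<close>

definition schema_size :: "'a set \<Rightarrow> 'a schema \<Rightarrow> nat" where
  "schema_size \<Sigma> S = 1 + (\<Sum>a \<in> \<Sigma>. 1 + length (srule S a))"


section \<open>Model of computation\<close>

text \<open>
  Algorithms are programs of a first-order, call-by-value functional language on binary cells whose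
  leaves are nil and alphabet symbols. Programs contain no symbol literals; the only operation on
  symbols is the order test \<open>Leq\<close>, so one program serves all alphabets. Every evaluation
  step costs one unit. As no step looks below the top constructor of a value (there is no test for
  structural equality), values can be kept as shared pointers, and the cost is, up to a factor
  that depends only on the program, the running time on a random access machine on which symbols
  are compared in constant time.
\<close>

datatype 'a val = VNil | VSym 'a | VPair "'a val" "'a val"

text \<open>Variables are de Bruijn indices into the environment; \<open>Call f es\<close> evaluates the body
  \<open>p ! f\<close> in the environment consisting of the values of \<open>es\<close>.\<close>

datatype expr =
    Var nat
  | NilE
  | PairE expr expr
  | Fst expr
  | Snd expr
  | IsPair expr
  | Leq expr expr
  | IfE expr expr expr
  | LetE expr expr
  | Call nat "expr list"

type_synonym prog = "expr list"

fun vfst :: "'a val \<Rightarrow> 'a val" where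
  "vfst (VPair v w) = v"
| "vfst v = VNil"

fun vsnd :: "'a val \<Rightarrow> 'a val" where
  "vsnd (VPair v w) = w"
| "vsnd v = VNil"

text \<open>Truth values: nil is false, every other value is true.\<close>

definition vbool :: "bool \<Rightarrow> 'a val" where
  "vbool b = (if b then VPair VNil VNil else VNil)"

fun vis_pair :: "'a val \<Rightarrow> 'a val" where
  "vis_pair (VPair v w) = vbool True"
| "vis_pair v = vbool False"

fun vleq :: "'a::linorder val \<Rightarrow> 'a val \<Rightarrow> 'a val" where
  "vleq (VSym a) (VSym b) = vbool (a \<le> b)"
| "vleq v w = vbool False"

text \<open>\<open>eval p \<rho> e v t\<close>: in program \<open>p\<close> and environment \<open>\<rho>\<close>,
  \<open>e\<close> evaluates to \<open>v\<close> at cost \<open>t\<close>.\<close>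

inductive eval :: "prog \<Rightarrow> 'a::linorder val list \<Rightarrow> expr \<Rightarrow> 'a val \<Rightarrow> nat \<Rightarrow> bool"
  and evals :: "prog \<Rightarrow> 'a::linorder val list \<Rightarrow> expr list \<Rightarrow> 'a val list \<Rightarrow> nat \<Rightarrow> bool"
  for p :: prog
where
  Var: "i < length \<rho> \<Longrightarrow> eval p \<rho> (Var i) (\<rho> ! i) 1"
| NilE: "eval p \<rho> NilE VNil 1"
| PairE: "eval p \<rho> e1 v1 t1 \<Longrightarrow> eval p \<rho> e2 v2 t2 \<Longrightarrow>
    eval p \<rho> (PairE e1 e2) (VPair v1 v2) (t1 + t2 + 1)"
| Fst: "eval p \<rho> e v t \<Longrightarrow> eval p \<rho> (Fst e) (vfst v) (t + 1)"
| Snd: "eval p \<rho> e v t \<Longrightarrow> eval p \<rho> (Snd e) (vsnd v) (t + 1)"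
| IsPair: "eval p \<rho> e v t \<Longrightarrow> eval p \<rho> (IsPair e) (vis_pair v) (t + 1)"
| Leq: "eval p \<rho> e1 v1 t1 \<Longrightarrow> eval p \<rho> e2 v2 t2 \<Longrightarrow>
    eval p \<rho> (Leq e1 e2) (vleq v1 v2) (t1 + t2 + 1)"
| IfE_True: "eval p \<rho> e v t \<Longrightarrow> v \<noteq> VNil \<Longrightarrow> eval p \<rho> e1 v1 t1 \<Longrightarrow>
    eval p \<rho> (IfE e e1 e2) v1 (t + t1 + 1)"
| IfE_False: "eval p \<rho> e VNil t \<Longrightarrow> eval p \<rho> e2 v2 t2 \<Longrightarrow>
    eval p \<rho> (IfE e e1 e2) v2 (t + t2 + 1)"
| LetE: "eval p \<rho> e1 v1 t1 \<Longrightarrow> eval p (v1 # \<rho>) e2 v2 t2 \<Longrightarrow>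
    eval p \<rho> (LetE e1 e2) v2 (t1 + t2 + 1)"
| Call: "evals p \<rho> es vs t \<Longrightarrow> f < length p \<Longrightarrow> eval p vs (p ! f) v t' \<Longrightarrow>
    eval p \<rho> (Call f es) v (t + t' + 1)"
| evals_Nil: "evals p \<rho> [] [] 0"
| evals_Cons: "eval p \<rho> e v t \<Longrightarrow> evals p \<rho> es vs t' \<Longrightarrow>
    evals p \<rho> (e # es) (v # vs) (t + t')"

text \<open>Function 0 is the entry point.\<close>

definition runs :: "prog \<Rightarrow> 'a::linorder val \<Rightarrow> 'a val \<Rightarrow> nat \<Rightarrow> bool" where
  "runs p v r t \<longleftrightarrow> eval p [v] (Call 0 [Var 0]) r t"

inductive_cases eval_elims:
  "eval p \<rho> (Var i) v t" "eval p \<rho> NilE v t" "eval p \<rho> (PairE e1 e2) v t"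
  "eval p \<rho> (Fst e) v t" "eval p \<rho> (Snd e) v t" "eval p \<rho> (IsPair e) v t"
  "eval p \<rho> (Leq e1 e2) v t" "eval p \<rho> (IfE e e1 e2) v t" "eval p \<rho> (LetE e1 e2) v t"
  "eval p \<rho> (Call f es) v t"
inductive_cases evals_elims: "evals p \<rho> [] vs t" "evals p \<rho> (e # es) vs t"

lemma eval_deterministic:
  "eval p \<rho> e v t \<Longrightarrow> eval p \<rho> e v' t' \<Longrightarrow> v' = v \<and> t' = t"
  "evals p \<rho> es vs t \<Longrightarrow> evals p \<rho> es vs' t' \<Longrightarrow> vs' = vs \<and> t' = t"
  by (induction arbitrary: v' t' and vs' t' rule: eval_evals.inducts)
     (erule eval_elims evals_elims; (metis Suc_eq_plus1 | (simp; fail)))+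


section \<open>Encoding of data as values\<close>

text \<open>
  A finite set is presented by listing its members without repetition in an arbitrary order. So
  sets, and objects built from them, have several encodings; a learner must be correct on each.
\<close>

fun vlist :: "'a val list \<Rightarrow> 'a val" where
  "vlist [] = VNil"
| "vlist (v # vs) = VPair v (vlist vs)"

definition enc_set :: "('b \<Rightarrow> 'a val \<Rightarrow> bool) \<Rightarrow> 'b set \<Rightarrow> 'a val \<Rightarrow> bool" where
  "enc_set enc X v \<longleftrightarrow> (\<exists>xs vs. distinct xs \<and> set xs = X \<and> list_all2 enc xs vs \<and> v = vlist vs)"

lemma enc_set_mono [mono]:
  "(\<And>x v. enc x v \<longrightarrow> enc' x v) \<Longrightarrow> enc_set enc X v \<longrightarrow> enc_set enc' X v"
  unfolding enc_set_def by (blast intro: list_all2_mono)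

definition enc_sym :: "'a \<Rightarrow> 'a val \<Rightarrow> bool" where
  "enc_sym a v \<longleftrightarrow> v = VSym a"

text \<open>A node is encoded by its label and the encodings of its children, so the encoding of a tree
  does not mention node identities, and its size is linear in the number of nodes.\<close>

inductive enc_node :: "'a tree \<Rightarrow> nat \<Rightarrow> 'a val \<Rightarrow> bool" for t :: "'a tree" where
  "enc_set (enc_node t) {m. (n, m) \<in> tchild t} v \<Longrightarrow> enc_node t n (VPair (VSym (tlab t n)) v)"

definition enc_tree :: "'a tree \<Rightarrow> 'a val \<Rightarrow> bool" where
  "enc_tree t = enc_node t (troot t)"

fun enc_mult :: "mult \<Rightarrow> 'a val" where
  "enc_mult Zero = vlist []"
| "enc_mult One = vlist [VNil]"
| "enc_mult Opt = vlist [VNil, VNil]"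
| "enc_mult Plus = vlist [VNil, VNil, VNil]"
| "enc_mult Star = vlist [VNil, VNil, VNil, VNil]"

definition enc_mexpr :: "'a mexpr \<Rightarrow> 'a val" where
  "enc_mexpr E = vlist (map (\<lambda>(a, M). VPair (VSym a) (enc_mult M)) E)"

text \<open>The rule map is encoded by its graph.\<close>

definition enc_schema :: "'a set \<Rightarrow> 'a schema \<Rightarrow> 'a val \<Rightarrow> bool" where
  "enc_schema \<Sigma> S v \<longleftrightarrow> (\<exists>u. v = VPair (VSym (sroot S)) u \<and>
     enc_set (\<lambda>a x. x = VPair (VSym a) (enc_mexpr (srule S a))) \<Sigma> u)"


section \<open>Learnability in polynomial time and data\<close>

record ('e, 'c) learning_setting =
  examples :: "'e set"
  concepts :: "'c set"
  language :: "'c \<Rightarrow> 'e set"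

record ('a, 'e, 'c) representation =
  example_size :: "'e \<Rightarrow> nat"
  concept_size :: "'c \<Rightarrow> nat"
  enc_example :: "'e \<Rightarrow> 'a val \<Rightarrow> bool"
  enc_concept :: "'c \<Rightarrow> 'a val \<Rightarrow> bool"

definition sample :: "('e, 'c) learning_setting \<Rightarrow> 'e set \<Rightarrow> bool" where
  "sample X D \<longleftrightarrow> finite D \<and> D \<noteq> {} \<and> D \<subseteq> examples X"

definition consistent :: "('e, 'c) learning_setting \<Rightarrow> 'e set \<Rightarrow> 'c \<Rightarrow> bool" where
  "consistent X D c \<longleftrightarrow> D \<subseteq> language X c"

definition sample_size :: "('a, 'e, 'c) representation \<Rightarrow> 'e set \<Rightarrow> nat" where
  "sample_size Y D = (\<Sum>x \<in> D. example_size Y x)"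

abbreviation null :: "'a val" where
  "null \<equiv> VNil"

text \<open>The alphabet is part of the input.\<close>

definition enc_input ::
    "('a, 'e, 'c) representation \<Rightarrow> 'a set \<Rightarrow> 'e set \<Rightarrow> 'a val \<Rightarrow> bool" where
  "enc_input Y \<Sigma> D v \<longleftrightarrow>
     (\<exists>u w. v = VPair u w \<and> enc_set enc_sym \<Sigma> u \<and> enc_set (enc_example Y) D w)"

definition input_size :: "('a, 'e, 'c) representation \<Rightarrow> 'a set \<Rightarrow> 'e set \<Rightarrow> nat" where
  "input_size Y \<Sigma> D = card \<Sigma> + sample_size Y D"

definition polynomial_time ::
    "('a::linorder set \<Rightarrow> ('e, 'c) learning_setting) \<Rightarrow> ('a set \<Rightarrow> ('a, 'e, 'c) representation) \<Rightarrow>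
     prog \<Rightarrow> bool" where
  "polynomial_time X Y learner \<longleftrightarrow> (\<exists>q :: nat poly. \<forall>\<Sigma> D v.
     finite \<Sigma> \<and> sample (X \<Sigma>) D \<and> enc_input (Y \<Sigma>) \<Sigma> D v \<longrightarrow>
     (\<exists>r t. runs learner v r t \<and> t \<le> poly q (input_size (Y \<Sigma>) \<Sigma> D)))"

definition sound ::
    "('a::linorder set \<Rightarrow> ('e, 'c) learning_setting) \<Rightarrow> ('a set \<Rightarrow> ('a, 'e, 'c) representation) \<Rightarrow>
     prog \<Rightarrow> bool" where
  "sound X Y learner \<longleftrightarrow> (\<forall>\<Sigma> D v r t.
     finite \<Sigma> \<and> sample (X \<Sigma>) D \<and> enc_input (Y \<Sigma>) \<Sigma> D v \<and> runs learner v r t \<longrightarrow>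
     (\<exists>c \<in> concepts (X \<Sigma>). enc_concept (Y \<Sigma>) c r \<and> consistent (X \<Sigma>) D c) \<or>
     r = null \<and> \<not> (\<exists>c \<in> concepts (X \<Sigma>). consistent (X \<Sigma>) D c))"

text \<open>
  A characteristic sample has to be consistent with its concept, as otherwise there would be no
  \<open>D\<close> between \<open>CS\<close> and the language of \<open>c\<close>, and completeness would say nothing
  about \<open>c\<close>. The only exception is a concept with empty language, for which no sample is
  consistent.
\<close>

definition complete ::
    "('a::linorder set \<Rightarrow> ('e, 'c) learning_setting) \<Rightarrow> ('a set \<Rightarrow> ('a, 'e, 'c) representation) \<Rightarrow>
     prog \<Rightarrow> bool" where
  "complete X Y learner \<longleftrightarrow> (\<exists>q :: nat poly. \<forall>\<Sigma>. finite \<Sigma> \<longrightarrow> (\<forall>c \<in> concepts (X \<Sigma>).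
     \<exists>CS. sample (X \<Sigma>) CS \<and> card CS \<le> poly q (concept_size (Y \<Sigma>) c) \<and>
       (language (X \<Sigma>) c \<noteq> {} \<longrightarrow> consistent (X \<Sigma>) CS c) \<and>
       (\<forall>D v r t. sample (X \<Sigma>) D \<and> CS \<subseteq> D \<and> consistent (X \<Sigma>) D c \<and>
          enc_input (Y \<Sigma>) \<Sigma> D v \<and> runs learner v r t \<longrightarrow>
          (\<exists>c' \<in> concepts (X \<Sigma>). enc_concept (Y \<Sigma>) c' r \<and>
             language (X \<Sigma>) c' = language (X \<Sigma>) c))))"

definition learnable_in_polynomial_time_and_data ::
    "('a::linorder set \<Rightarrow> ('e, 'c) learning_setting) \<Rightarrow> ('a set \<Rightarrow> ('a, 'e, 'c) representation) \<Rightarrow>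
     bool" where
  "learnable_in_polynomial_time_and_data X Y \<longleftrightarrow>
     (\<exists>learner. polynomial_time X Y learner \<and> sound X Y learner \<and> complete X Y learner)"

definition MS :: "'a set \<Rightarrow> ('a tree, 'a schema) learning_setting" where
  "MS \<Sigma> = \<lparr>examples = trees \<Sigma>, concepts = schemas \<Sigma>, language = schema_lang \<Sigma>\<rparr>"

definition MS_rep :: "'a set \<Rightarrow> ('a, 'a tree, 'a schema) representation" where
  "MS_rep \<Sigma> = \<lparr>example_size = tree_size, concept_size = schema_size \<Sigma>,
     enc_example = enc_tree, enc_concept = enc_schema \<Sigma>\<rparr>"

end

theory Submission imports Defs begin

text \<open>
  The learner returns null if two example trees have different root labels. Otherwise the common
  root label is the root of its schema, and the multiplicity of \<open>b\<close> in the rule of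
  \<open>a\<close> is the least one that contains all numbers of \<open>b\<close>-children observed at nodes
  labelled \<open>a\<close>. This least multiplicity depends only on whether a number
  \<open>= 0\<close>, \<open>\<ge> 1\<close> or \<open>\<ge> 2\<close> has been observed. Hence one witness in
  \<open>L(S)\<close> for each of these properties that some tree of \<open>L(S)\<close> has, with \<open>b\<close>
  ranging over the symbols in the rule of \<open>a\<close>, and one tree for each label \<open>a\<close> that
  occurs at all, force the learner to output the schema it would obtain from the whole of
  \<open>L(S)\<close>, and that schema is equivalent to \<open>S\<close>. In particular, no analysis of which
  symbols generate finite trees is needed.
\<close>

section \<open>Symbolic execution of programs\<close>

text \<open>Weakest preconditions for total correctness: a postcondition speaks about value and
  cost, so rewriting with \<open>wp_simps\<close> yields termination, result and running time at
  once.\<close>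

definition wp :: "prog \<Rightarrow> 'a::linorder val list \<Rightarrow> expr \<Rightarrow> ('a val \<Rightarrow> nat \<Rightarrow> bool) \<Rightarrow> bool" where
  "wp p \<rho> e Q \<longleftrightarrow> (\<exists>v t. eval p \<rho> e v t \<and> Q v t)"

definition wps ::
    "prog \<Rightarrow> 'a::linorder val list \<Rightarrow> expr list \<Rightarrow> ('a val list \<Rightarrow> nat \<Rightarrow> bool) \<Rightarrow> bool" where
  "wps p \<rho> es Q \<longleftrightarrow> (\<exists>vs t. evals p \<rho> es vs t \<and> Q vs t)"

text \<open>Kept apart from \<open>wp\<close> so that \<open>wp_simps\<close> stops at calls: a body
  is opened once, by \<open>call_def\<close>, and the calls inside it are rewritten with their
  specifications.\<close>

definition call :: "prog \<Rightarrow> nat \<Rightarrow> 'a::linorder val list \<Rightarrow> ('a val \<Rightarrow> nat \<Rightarrow> bool) \<Rightarrow> bool" where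
  "call p f vs Q \<longleftrightarrow> f < length p \<and> wp p vs (p ! f) Q"

lemma wp_simps:
  "wp p \<rho> (Var i) Q \<longleftrightarrow> i < length \<rho> \<and> Q (\<rho> ! i) 1"
  "wp p \<rho> NilE Q \<longleftrightarrow> Q VNil 1"
  "wp p \<rho> (PairE e1 e2) Q \<longleftrightarrow>
     wp p \<rho> e1 (\<lambda>v1 t1. wp p \<rho> e2 (\<lambda>v2 t2. Q (VPair v1 v2) (t1 + t2 + 1)))"
  "wp p \<rho> (Fst e) Q \<longleftrightarrow> wp p \<rho> e (\<lambda>v t. Q (vfst v) (t + 1))"
  "wp p \<rho> (Snd e) Q \<longleftrightarrow> wp p \<rho> e (\<lambda>v t. Q (vsnd v) (t + 1))"
  "wp p \<rho> (IsPair e) Q \<longleftrightarrow> wp p \<rho> e (\<lambda>v t. Q (vis_pair v) (t + 1))"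
  "wp p \<rho> (Leq e1 e2) Q \<longleftrightarrow>
     wp p \<rho> e1 (\<lambda>v1 t1. wp p \<rho> e2 (\<lambda>v2 t2. Q (vleq v1 v2) (t1 + t2 + 1)))"
  "wp p \<rho> (IfE e e1 e2) Q \<longleftrightarrow>
     wp p \<rho> e (\<lambda>v t. if v = VNil then wp p \<rho> e2 (\<lambda>v2 t2. Q v2 (t + t2 + 1))
                    else wp p \<rho> e1 (\<lambda>v1 t1. Q v1 (t + t1 + 1)))"
  "wp p \<rho> (LetE e1 e2) Q \<longleftrightarrow>
     wp p \<rho> e1 (\<lambda>v1 t1. wp p (v1 # \<rho>) e2 (\<lambda>v2 t2. Q v2 (t1 + t2 + 1)))"
  "wp p \<rho> (Call f es) Q \<longleftrightarrow> wps p \<rho> es (\<lambda>vs t. call p f vs (\<lambda>v t'. Q v (t + t' + 1)))"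
  "wps p \<rho> [] R \<longleftrightarrow> R [] 0"
  "wps p \<rho> (e # es) R \<longleftrightarrow> wp p \<rho> e (\<lambda>v t. wps p \<rho> es (\<lambda>vs t'. R (v # vs) (t + t')))"
  unfolding wp_def wps_def call_def
  by (fastforce intro: eval_evals.intros elim!: eval_elims evals_elims split: if_splits)+

definition returns :: "prog \<Rightarrow> nat \<Rightarrow> 'a::linorder val list \<Rightarrow> 'a val \<Rightarrow> nat \<Rightarrow> bool" where
  "returns p f vs r T \<longleftrightarrow> call p f vs (\<lambda>v t. v = r \<and> t \<le> T)"

text \<open>Evaluation is deterministic, so a specification settles every postcondition. The
  resulting equivalence serves as a rewrite rule in which the exact cost \<open>t\<close> is known
  only up to its bound.\<close>

lemma call_eq:
  assumes "returns p f vs r T"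
  obtains t where "t \<le> T" "\<And>Q. call p f vs Q \<longleftrightarrow> Q r t"
proof -
  obtain t where t: "f < length p" "eval p vs (p ! f) r t" "t \<le> T"
    using assms unfolding returns_def call_def wp_def by blast
  have "call p f vs Q \<longleftrightarrow> Q r t" for Q
    unfolding call_def wp_def using t eval_deterministic(1) by blast
  with t show ?thesis using that by blast
qed


section \<open>The learner\<close>

abbreviation trueE :: expr where "trueE \<equiv> PairE NilE NilE"

abbreviation eqE :: "expr \<Rightarrow> expr \<Rightarrow> expr" where "eqE x y \<equiv> IfE (Leq x y) (Leq y x) NilE"

fun unaryE :: "nat \<Rightarrow> expr" where
  "unaryE 0 = NilE"
| "unaryE (Suc k) = PairE NilE (unaryE k)"

text \<open>Function 0 receives alphabet and forest and reads the root label off the first tree. In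
  function 5 the test is a unary number; under \<open>LetE\<close> it is \<open>Var 1\<close> and
  the child count is \<open>Var 0\<close>. The tests \<open>0\<close>, \<open>1\<close>,
  \<open>2\<close> stand for none, at least one, at least two.\<close>

definition learner :: prog where
  "learner =
    [ LetE (Fst (Fst (Snd (Var 0))))
        (IfE (Call 1 [Var 0, Snd (Var 1)])
          (PairE (Var 0) (Call 2 [Fst (Var 1), Fst (Var 1), Snd (Var 1)])) NilE),
      \<comment> \<open>1: do all trees of a forest have the given root label?\<close>
      IfE (IsPair (Var 1))
        (IfE (eqE (Var 0) (Fst (Fst (Var 1)))) (Call 1 [Var 0, Snd (Var 1)]) NilE) trueE,
      \<comment> \<open>2: rules for a list of symbols\<close>
      IfE (IsPair (Var 0))
        (PairE (PairE (Fst (Var 0)) (Call 3 [Var 1, Fst (Var 0), Var 2]))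
          (Call 2 [Snd (Var 0), Var 1, Var 2])) NilE,
      \<comment> \<open>3: factors for a list of symbols in the rule of a given symbol\<close>
      IfE (IsPair (Var 0))
        (PairE (PairE (Fst (Var 0)) (Call 4 [Var 1, Fst (Var 0), Var 2]))
          (Call 3 [Snd (Var 0), Var 1, Var 2])) NilE,
      \<comment> \<open>4: multiplicity of one symbol in the rule of another\<close>
      IfE (Call 5 [unaryE 2, Var 0, Var 1, Var 2])
        (IfE (Call 5 [unaryE 0, Var 0, Var 1, Var 2]) (unaryE 4) (unaryE 3))
        (IfE (Call 5 [unaryE 1, Var 0, Var 1, Var 2])
          (IfE (Call 5 [unaryE 0, Var 0, Var 1, Var 2]) (unaryE 2) (unaryE 1)) (unaryE 0)),
      \<comment> \<open>5: has some node labelled \<open>Var 1\<close> a number of \<open>Var 2\<close>-children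
          passing test \<open>Var 0\<close>?\<close>
      IfE (IsPair (Var 3))
        (IfE
          (IfE (eqE (Var 1) (Fst (Fst (Var 3))))
            (LetE (Call 6 [Var 2, Snd (Fst (Var 3))])
              (IfE (Var 1) (IfE (Snd (Var 1)) (Snd (Var 0)) (Var 0)) (IfE (Var 0) NilE trueE)))
            NilE)
          trueE
          (IfE (Call 5 [Var 0, Var 1, Var 2, Snd (Fst (Var 3))]) trueE
            (Call 5 [Var 0, Var 1, Var 2, Snd (Var 3)])))
        NilE,
      \<comment> \<open>6: number of root labels of a forest that equal the given symbol, in unary\<close>
      IfE (IsPair (Var 1))
        (IfE (eqE (Var 0) (Fst (Fst (Var 1))))
          (PairE NilE (Call 6 [Var 0, Snd (Var 1)])) (Call 6 [Var 0, Snd (Var 1)]))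
        NilE ]"

lemmas learner_nth =
  arg_cong[OF learner_def, of "\<lambda>p. p ! 0", simplified]
  arg_cong[OF learner_def, of "\<lambda>p. p ! 1", simplified]
  arg_cong[OF learner_def, of "\<lambda>p. p ! 2", simplified]
  arg_cong[OF learner_def, of "\<lambda>p. p ! 3", simplified]
  arg_cong[OF learner_def, of "\<lambda>p. p ! 4", simplified]
  arg_cong[OF learner_def, of "\<lambda>p. p ! 5", simplified]
  arg_cong[OF learner_def, of "\<lambda>p. p ! 6", simplified]

lemma length_learner: "length learner = 7"
  by (simp add: learner_def)

lemmas exec_simps = wp_simps vbool_def learner_nth length_learner

text \<open>Left-child right-sibling view: \<open>Branch a f g\<close> is a tree with root label \<open>a\<close> and
  subtrees \<open>f\<close>, followed by the trees \<open>g\<close>.\<close>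

datatype 'a forest = Empty | Branch 'a "'a forest" "'a forest"

fun fval :: "'a forest \<Rightarrow> 'a val" where
  "fval Empty = VNil"
| "fval (Branch a f g) = VPair (VPair (VSym a) (fval f)) (fval g)"

fun roots :: "'a forest \<Rightarrow> 'a list" where
  "roots Empty = []"
| "roots (Branch a f g) = a # roots g"

text \<open>\<open>count_list (roots f)\<close> is the child word of a node whose subtrees form
  \<open>f\<close>, so this is the counterpart of \<open>observations\<close> on forests.\<close>

fun fobs :: "'a forest \<Rightarrow> ('a \<times> 'a uword) set" where
  "fobs Empty = {}"
| "fobs (Branch a f g) = insert (a, count_list (roots f)) (fobs f \<union> fobs g)"

fun unary :: "nat \<Rightarrow> 'a val" where
  "unary 0 = VNil"
| "unary (Suc k) = VPair VNil (unary k)"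

lemma unary_eq_VNil [simp]: "unary k = VNil \<longleftrightarrow> k = 0"
  by (cases k) auto

lemma vsnd_unary [simp]: "vsnd (unary k) = unary (k - 1)"
  by (cases k) auto

lemma wp_unaryE: "wp p \<rho> (unaryE k) Q \<longleftrightarrow> Q (unary k) (2 * k + 1)"
  by (induction k arbitrary: Q) (simp_all add: wp_simps)

section \<open>Results and running times of the functions of the learner\<close>

lemma returns_count:
  "returns learner 6 [VSym b, fval F] (unary (count_list (roots F) b)) (30 * (size F + 1))"
proof (induction F)
  case Empty
  show ?case unfolding returns_def
    by (subst call_def) (simp add: exec_simps)
next
  case (Branch a F G)
  from Branch(2) obtain t where t: "t \<le> 30 * (size G + 1)"
    "\<And>Q. call learner 6 [VSym b, fval G] Q \<longleftrightarrow> Q (unary (count_list (roots G) b)) t"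
    by (rule call_eq) blast
  show ?case unfolding returns_def
    using t(1) by (subst call_def) (auto simp add: exec_simps t(2))
qed

lemma returns_same:
  "returns learner 1 [VSym r, fval F] (vbool (\<forall>a \<in> set (roots F). a = r)) (30 * (size F + 1))"
proof (induction F)
  case Empty
  show ?case unfolding returns_def
    by (subst call_def) (simp add: exec_simps)
next
  case (Branch a F G)
  from Branch(2) obtain t where t: "t \<le> 30 * (size G + 1)"
    "\<And>Q. call learner 1 [VSym r, fval G] Q \<longleftrightarrow> Q (vbool (\<forall>a \<in> set (roots G). a = r)) t"
    by (rule call_eq) blast
  \<comment> \<open>Simplification turns the function index \<open>1\<close> into
    \<open>Suc 0\<close>; the equation for the recursive call has to be in that form.\<close>
  show ?case unfolding returns_def
    using t(1) by (subst call_def) (auto simp add: exec_simps t(2)[unfolded One_nat_def])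
qed

definition passes :: "nat \<Rightarrow> nat \<Rightarrow> bool" where
  "passes m k \<longleftrightarrow> (if m = 0 then k = 0 else m \<le> k)"

text \<open>The quadratic bound is kept by the recursion, as
  \<open>(x + y)\<^sup>2 = x\<^sup>2 + y\<^sup>2 + 2 x y\<close> and \<open>x + y \<le> 2 x y\<close> for positive \<open>x\<close>, \<open>y\<close>.\<close>

lemma returns_exists:
  assumes "m \<le> 2"
  shows "returns learner 5 [unary m, VSym a, VSym b, fval F]
    (vbool (\<exists>w. (a, w) \<in> fobs F \<and> passes m (w b))) (90 * (size F + 1)\<^sup>2)"
proof (induction F)
  case Empty
  show ?case unfolding returns_def
    by (subst call_def) (simp add: exec_simps)
next
  case (Branch c F G)
  define ex where "ex F \<longleftrightarrow> (\<exists>w. (a, w) \<in> fobs F \<and> passes m (w b))" for F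
  \<comment> \<open>Hiding \<open>unary m\<close> behind \<open>u\<close> keeps it from being
    simplified; the body inspects it only through the two conditions shown next.\<close>
  define u :: "'a val" where "u = unary m"
  have u: "u = VNil \<longleftrightarrow> m = 0" "vsnd u = VNil \<longleftrightarrow> m \<le> 1"
    by (auto simp add: u_def)
  from Branch(1) obtain t where t: "t \<le> 90 * (size F + 1)\<^sup>2"
    "\<And>Q. call learner 5 [u, VSym a, VSym b, fval F] Q \<longleftrightarrow> Q (vbool (ex F)) t"
    unfolding ex_def[symmetric] u_def[symmetric] by (rule call_eq) blast
  from Branch(2) obtain t' where t': "t' \<le> 90 * (size G + 1)\<^sup>2"
    "\<And>Q. call learner 5 [u, VSym a, VSym b, fval G] Q \<longleftrightarrow> Q (vbool (ex G)) t'"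
    unfolding ex_def[symmetric] u_def[symmetric] by (rule call_eq) blast
  define k where "k = count_list (roots F) b"
  obtain s where s: "s \<le> 30 * (size F + 1)"
    "\<And>Q. call learner 6 [VSym b, fval F] Q \<longleftrightarrow> Q (unary k) s"
    unfolding k_def using returns_count by (rule call_eq) blast
  define x y where "x = size F + 1" and "y = size G + 1"
  have "x + y \<le> 2 * (x * y)"
    using mult_le_mono[of 1 x 1 y] mult_le_mono[of 1 x y y] mult_le_mono[of x x 1 y]
    by (simp add: x_def y_def)
  then have T: "90 * x\<^sup>2 + 90 * y\<^sup>2 + 90 * (x + y) \<le> 90 * (x + y)\<^sup>2"
    by (simp add: power2_eq_square algebra_simps)
  define B where "B = 90 * (size (Branch c F G) + 1)\<^sup>2"
  have sz: "size (Branch c F G) + 1 = x + y"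
    by (simp add: x_def y_def)
  have le: "s + (t + t') + 80 \<le> B"
    unfolding B_def sz using T s(1) t(1) t'(1) by (simp add: x_def y_def)
  have ex: "ex (Branch c F G) \<longleftrightarrow> c = a \<and> passes m k \<or> ex F \<or> ex G"
    by (auto simp add: ex_def k_def)
  show ?case unfolding returns_def ex_def[symmetric] u_def[symmetric] B_def[symmetric] ex
    using le assms
    by (subst call_def)
      (cases "c = a"; cases "ex F"; cases "ex G"; cases "m = 0"; cases "k = 0"; cases "m = 1";
        auto simp add: exec_simps t(2) t'(2) s(2) u passes_def)
qed

text \<open>The tests come in the order of function 4. For an empty \<open>K\<close>, that is, below
  a label never observed, the value is \<open>Zero\<close> by default.\<close>

definition least_mult :: "nat set \<Rightarrow> mult" where
  "least_mult K =
    (if \<exists>k \<in> K. passes 2 k then (if \<exists>k \<in> K. passes 0 k then Star else Plus)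
     else if \<exists>k \<in> K. passes 1 k then (if \<exists>k \<in> K. passes 0 k then Opt else One) else Zero)"

definition counts :: "('a \<times> 'a uword) set \<Rightarrow> 'a \<Rightarrow> 'a \<Rightarrow> nat set" where
  "counts X a b = {w b | w. (a, w) \<in> X}"

definition learned_rule :: "'a list \<Rightarrow> ('a \<times> 'a uword) set \<Rightarrow> 'a \<Rightarrow> 'a mexpr" where
  "learned_rule bs X a = map (\<lambda>b. (b, least_mult (counts X a b))) bs"

lemma unary_mult: "unary 2 = enc_mult Opt" "unary 3 = enc_mult Plus" "unary 4 = enc_mult Star"
  by (simp_all add: eval_nat_numeral)

text \<open>At most three scans by function 5 are made, each within
  \<open>90 * (size F + 1)\<^sup>2\<close>; the remainder absorbs the constant costs.\<close>

lemma returns_mult: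
  "returns learner 4 [VSym a, VSym b, fval F] (enc_mult (least_mult (counts (fobs F) a b)))
    (350 * (size F + 1)\<^sup>2)"
proof -
  define B where "B = (size F + 1)\<^sup>2"
  have B: "1 \<le> B" by (simp add: B_def)
  define ex where "ex m \<longleftrightarrow> (\<exists>k \<in> counts (fobs F) a b. passes m k)" for m
  have ex: "(\<exists>w. (a, w) \<in> fobs F \<and> passes m (w b)) \<longleftrightarrow> ex m" for m
    by (auto simp add: ex_def counts_def)
  have "\<exists>t \<le> 90 * B. \<forall>Q. call learner 5 [unary m, VSym a, VSym b, fval F] Q \<longleftrightarrow> Q (vbool (ex m)) t"
    if "m \<le> 2" for m
    using returns_exists[OF that, of a b F] unfolding ex B_def by (rule call_eq) blast
  then obtain t where t: "\<And>m. m \<le> 2 \<Longrightarrow> t m \<le> 90 * B"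
    "\<And>m Q. m \<le> 2 \<Longrightarrow>
       call learner 5 [unary m, VSym a, VSym b, fval F] Q \<longleftrightarrow> Q (vbool (ex m)) (t m)"
    by metis
  note t2 = t(2)[of 0] t(2)[of 1] t(2)[of 2]
  \<comment> \<open>\<open>unary 2\<close> is both a test and the code of \<open>Opt\<close>. As
    \<open>unary_mult\<close> rewrites it, the equations \<open>t2\<close> are brought to the same
    normal form.\<close>
  show ?thesis
    unfolding returns_def least_mult_def ex_def[symmetric] B_def[symmetric]
    using t(1)[of 0] t(1)[of 1] t(1)[of 2] B
    by (subst call_def)
      (cases "ex 0"; cases "ex 1"; cases "ex 2";
        simp add: exec_simps wp_unaryE t2[simplified unary_mult, simplified] unary_mult)
qed

lemma returns_mexpr:
  "returns learner 3 [vlist (map VSym bs), VSym a, fval F]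
    (enc_mexpr (learned_rule bs (fobs F) a)) ((length bs + 1) * (400 * (size F + 1)\<^sup>2))"
proof -
  define B where "B = (size F + 1)\<^sup>2"
  have B: "1 \<le> B" by (simp add: B_def)
  show ?thesis
    unfolding B_def[symmetric]
  proof (induction bs)
    case Nil
    show ?case unfolding returns_def
      using B by (subst call_def) (simp add: exec_simps enc_mexpr_def learned_rule_def)
  next
    case (Cons b bs)
    from Cons obtain t where t: "t \<le> (length bs + 1) * (400 * B)"
      "\<And>Q. call learner 3 [vlist (map VSym bs), VSym a, fval F] Q \<longleftrightarrow>
         Q (enc_mexpr (learned_rule bs (fobs F) a)) t"
      by (rule call_eq) blast
    obtain s where s: "s \<le> 350 * B"
      "\<And>Q. call learner 4 [VSym a, VSym b, fval F] Q \<longleftrightarrow>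
         Q (enc_mult (least_mult (counts (fobs F) a b))) s"
      unfolding B_def using returns_mult by (rule call_eq) blast
    show ?case unfolding returns_def
      using B s(1) t(1)
      by (subst call_def) (simp add: exec_simps t(2) s(2) enc_mexpr_def learned_rule_def)
  qed
qed

text \<open>Each nested loop contributes its length plus one. The coefficient grows from
  \<open>350\<close> over \<open>400\<close> to \<open>450\<close>, and each increase covers the
  constant cost of an iteration.\<close>

lemma returns_rules:
  "returns learner 2 [vlist (map VSym as), vlist (map VSym bs), fval F]
    (vlist (map (\<lambda>a. VPair (VSym a) (enc_mexpr (learned_rule bs (fobs F) a))) as))
    ((length as + 1) * ((length bs + 1) * (450 * (size F + 1)\<^sup>2)))"
proof -
  define B where "B = (length bs + 1) * (size F + 1)\<^sup>2"
  have B: "1 \<le> B" by (simp add: B_def Suc_le_eq)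
  have eq: "(length bs + 1) * (c * (size F + 1)\<^sup>2) = c * B" for c
    unfolding B_def by (rule mult.left_commute)
  let ?r = "\<lambda>as. vlist (map (\<lambda>a. VPair (VSym a) (enc_mexpr (learned_rule bs (fobs F) a))) as)"
  show ?thesis
    unfolding eq
  proof (induction as)
    case Nil
    show ?case unfolding returns_def
      using B by (subst call_def) (simp add: exec_simps)
  next
    case (Cons a as)
    from Cons obtain t where t: "t \<le> (length as + 1) * (450 * B)"
      "\<And>Q. call learner 2 [vlist (map VSym as), vlist (map VSym bs), fval F] Q \<longleftrightarrow> Q (?r as) t"
      by (rule call_eq) blast
    obtain s where s: "s \<le> 400 * B"
      "\<And>Q. call learner 3 [vlist (map VSym bs), VSym a, fval F] Q \<longleftrightarrow>
         Q (enc_mexpr (learned_rule bs (fobs F) a)) s"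
      unfolding eq[symmetric] using returns_mexpr by (rule call_eq) blast
    show ?case unfolding returns_def
      using B s(1) t(1)
      by (subst call_def) (simp add: exec_simps t(2) s(2))
  qed
qed

definition learned_val :: "'a list \<Rightarrow> 'a forest \<Rightarrow> 'a val" where
  "learned_val as F =
    (if \<forall>a \<in> set (roots F). a = hd (roots F)
     then VPair (VSym (hd (roots F)))
       (vlist (map (\<lambda>a. VPair (VSym a) (enc_mexpr (learned_rule as (fobs F) a))) as))
     else VNil)"

text \<open>The number of multiplicities is quadratic in the alphabet, and each takes time quadratic
  in the forest, whence the fourth power. \<open>F \<noteq> Empty\<close> provides the first tree,
  whose label is read.\<close>

lemma runs_learner:
  assumes "F \<noteq> Empty"
  shows "\<exists>t \<le> 600 * (length as + size F + 1) ^ 4.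
    runs learner (VPair (vlist (map VSym as)) (fval F)) (learned_val as F) t"
proof -
  obtain r F1 F2 where F: "F = Branch r F1 F2" using assms by (cases F) auto
  define N where "N = length as + size F + 1"
  define B where "B = (length as + 1) * ((length as + 1) * (size F + 1)\<^sup>2)"
  have "1 \<le> (length as + 1) * (length as + 1)" by simp
  then have "(size F + 1) * 1 \<le> (size F + 1) * ((length as + 1) * (length as + 1) * (size F + 1))"
    by (intro mult_le_mono2) simp
  then have B: "size F + 1 \<le> B"
    by (simp add: B_def power2_eq_square algebra_simps)
  have "B \<le> N * (N * N\<^sup>2)"
    unfolding B_def N_def by (intro mult_le_mono power_mono) auto
  then have BN: "B \<le> N ^ 4"
    by (simp add: eval_nat_numeral algebra_simps)
  let ?rules = "vlist (map (\<lambda>a. VPair (VSym a) (enc_mexpr (learned_rule as (fobs F) a))) as)"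
  obtain s where s: "s \<le> 30 * (size F + 1)"
    "\<And>Q. call learner 1 [VSym r, fval F] Q \<longleftrightarrow> Q (vbool (\<forall>a \<in> set (roots F). a = r)) s"
    using returns_same by (rule call_eq) blast
  have eq: "(length as + 1) * ((length as + 1) * (450 * (size F + 1)\<^sup>2)) = 450 * B"
    by (simp add: B_def)
  obtain t where t: "t \<le> 450 * B"
    "\<And>Q. call learner 2 [vlist (map VSym as), vlist (map VSym as), fval F] Q \<longleftrightarrow> Q ?rules t"
    unfolding eq[symmetric] using returns_rules by (rule call_eq) blast
  have fvF: "vfst (vfst (fval F)) = VSym r" "hd (roots F) = r"
    by (simp_all add: F)
  have "1 \<le> size F" by (simp add: F)
  then have "s + t + 60 \<le> 600 * B"
    using B s(1) t(1) by auto
  also have "\<dots> \<le> 600 * N ^ 4"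
    using BN by simp
  finally have "wp learner [VPair (vlist (map VSym as)) (fval F)] (Call 0 [Var 0])
      (\<lambda>v t. v = learned_val as F \<and> t \<le> 600 * N ^ 4)"
    unfolding wp_simps
    by (subst call_def)
      (simp add: exec_simps s(2)[unfolded One_nat_def] t(2) fvF learned_val_def)
  then show ?thesis
    unfolding wp_def runs_def N_def by blast
qed


section \<open>Encodings of trees and samples\<close>

definition observations :: "'a tree set \<Rightarrow> ('a \<times> 'a uword) set" where
  "observations D = {(tlab t n, ch t n) | t n. t \<in> D \<and> n \<in> tnodes t}"

text \<open>The nodes of the subtree at \<open>n\<close>, which is what \<open>enc_node\<close>
  encodes.\<close>

definition desc :: "'a tree \<Rightarrow> nat \<Rightarrow> nat set" where
  "desc t n = {m. (n, m) \<in> (tchild t)\<^sup>*}"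

section \<open>Parents, descendants and subtree sizes in trees\<close>

lemma treesD:
  assumes "t \<in> trees \<Sigma>"
  shows "finite (tnodes t)" "troot t \<in> tnodes t" "tlab t \<in> tnodes t \<rightarrow>\<^sub>E \<Sigma>"
    "tchild t \<subseteq> tnodes t \<times> tnodes t" "acyclic (tchild t)"
    "\<And>n. n \<in> tnodes t \<Longrightarrow> n \<noteq> troot t \<Longrightarrow> \<exists>!m. (m, n) \<in> tchild t"
  using assms unfolding trees_def by auto

lemma tree_wf:
  assumes "t \<in> trees \<Sigma>"
  shows "wf (tchild t)"
  using treesD(1,4,5)[OF assms] by (blast intro: finite_acyclic_wf finite_subset)

text \<open>The definition of trees does not say this directly. A proper ancestor of the root
  differs from the root by acyclicity, so it has a parent, again a proper ancestor; climbing on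
  contradicts well-foundedness.\<close>

lemma root_no_parent:
  assumes t: "t \<in> trees \<Sigma>"
  shows "(m, troot t) \<notin> tchild t"
proof -
  have "m \<in> tnodes t \<Longrightarrow> (m, troot t) \<notin> (tchild t)\<^sup>+" for m
  proof (induction m rule: wf_induct_rule[OF tree_wf[OF t]])
    case (1 m)
    show ?case
    proof
      assume m: "(m, troot t) \<in> (tchild t)\<^sup>+"
      then have "m \<noteq> troot t"
        using treesD(5)[OF t] by (auto simp: acyclic_def)
      then obtain k where k: "(k, m) \<in> tchild t"
        using treesD(6)[OF t] 1(2) by blast
      with m have "(k, troot t) \<in> (tchild t)\<^sup>+" by auto
      with 1(1)[OF k] k treesD(4)[OF t] show False by blast
    qed
  qed
  then show ?thesis using treesD(4)[OF t] by blast
qed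

lemma parent_unique:
  assumes t: "t \<in> trees \<Sigma>"
  shows "single_valued ((tchild t)\<inverse>)"
proof (rule single_valuedI)
  fix n m m'
  assume "(n, m) \<in> (tchild t)\<inverse>" "(n, m') \<in> (tchild t)\<inverse>"
  then show "m = m'"
    using treesD(4,6)[OF t] root_no_parent[OF t] by blast
qed

lemma desc_root:
  assumes t: "t \<in> trees \<Sigma>"
  shows "desc t (troot t) = tnodes t"
proof
  have "m \<in> tnodes t" if "(troot t, m) \<in> (tchild t)\<^sup>*" for m
    using that by (cases rule: rtranclE) (use treesD(2,4)[OF t] in auto)
  then show "desc t (troot t) \<subseteq> tnodes t" unfolding desc_def by blast
  have "m \<in> tnodes t \<Longrightarrow> (troot t, m) \<in> (tchild t)\<^sup>*" for m
  proof (induction m rule: wf_induct_rule[OF tree_wf[OF t]])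
    case (1 m)
    show ?case
    proof (cases "m = troot t")
      case False
      then obtain k where k: "(k, m) \<in> tchild t"
        using treesD(6)[OF t] 1(2) by blast
      with 1(1)[OF k] treesD(4)[OF t] show ?thesis
        by (blast intro: rtrancl_into_rtrancl)
    qed simp
  qed
  then show "tnodes t \<subseteq> desc t (troot t)" unfolding desc_def by blast
qed

lemma desc_unfold: "desc t n = insert n (\<Union>m \<in> {m. (n, m) \<in> tchild t}. desc t m)"
  unfolding desc_def
  by (auto intro: converse_rtrancl_into_rtrancl elim: converse_rtranclE)

lemma finite_desc:
  assumes t: "t \<in> trees \<Sigma>"
  shows "finite (desc t n)"
proof -
  have "desc t n \<subseteq> insert n (tnodes t)"
    unfolding desc_def using treesD(4)[OF t] by (auto elim: rtranclE)
  then show ?thesis using treesD(1)[OF t] finite_subset by blast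
qed

text \<open>Distinct children have disjoint subtrees. This recursion is what makes the size of the
  encoded forest equal to the number of nodes.\<close>

lemma card_desc:
  assumes t: "t \<in> trees \<Sigma>"
  shows "card (desc t n) = Suc (\<Sum>m | (n, m) \<in> tchild t. card (desc t m))"
proof -
  let ?C = "{m. (n, m) \<in> tchild t}"
  have C: "finite ?C"
    using treesD(1,4)[OF t] by (auto intro: finite_subset[of _ "tnodes t"])
  have acyc: "(m, n) \<notin> (tchild t)\<^sup>*" if "m \<in> ?C" for m
    using that treesD(5)[OF t] unfolding acyclic_def
    by (metis mem_Collect_eq rtrancl_into_trancl2)
  \<comment> \<open>A sibling is never below another: the last step of a nonempty path into
    \<open>d\<close> starts at the unique parent \<open>n\<close>, so \<open>c\<close> would reach
    its own parent.\<close>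
  have comparable: "c = d" if c: "c \<in> ?C" and d: "d \<in> ?C" and cd: "(c, d) \<in> (tchild t)\<^sup>*" for c d
    using cd
  proof (cases rule: rtranclE)
    case (step k)
    then have "k = n"
      using d single_valuedD[OF parent_unique[OF t], of d k n] by simp
    with step acyc[OF c] show ?thesis by simp
  qed
  have "desc t c \<inter> desc t d = {}" if c: "c \<in> ?C" and d: "d \<in> ?C" and "c \<noteq> d" for c d
  proof (rule ccontr)
    assume "desc t c \<inter> desc t d \<noteq> {}"
    then obtain m where "(m, c) \<in> ((tchild t)\<inverse>)\<^sup>*" "(m, d) \<in> ((tchild t)\<inverse>)\<^sup>*"
      unfolding desc_def by (auto simp: rtrancl_converse)
    \<comment> \<open>As parents are unique, any two ancestors of a node lie on one upward
      path.\<close>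
    from single_valued_confluent[OF parent_unique[OF t] this]
    have "(c, d) \<in> (tchild t)\<^sup>* \<or> (d, c) \<in> (tchild t)\<^sup>*"
      by (auto simp: rtrancl_converse)
    with comparable c d \<open>c \<noteq> d\<close> show False by blast
  qed
  then have "card (\<Union>m \<in> ?C. desc t m) = (\<Sum>m \<in> ?C. card (desc t m))"
    using C finite_desc[OF t] by (intro card_UN_disjoint) auto
  moreover have "n \<notin> (\<Union>m \<in> ?C. desc t m)"
    using acyc unfolding desc_def by auto
  ultimately show ?thesis
    using C finite_desc[OF t] by (subst desc_unfold) simp
qed

section \<open>Encoded nodes and samples as forests\<close>

definition node_val :: "'a \<Rightarrow> ('a \<times> 'a uword) set \<Rightarrow> nat \<Rightarrow> 'a val \<Rightarrow> bool" where
  "node_val a X k v \<longleftrightarrow>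
     (\<exists>F. v = VPair (VSym a) (fval F) \<and> X = insert (a, count_list (roots F)) (fobs F) \<and>
          k = Suc (size F))"

text \<open>The list elements become a chain of siblings. With \<open>l\<close>, \<open>X\<close>
  and \<open>k\<close> arbitrary, this serves for the children of a node as well as for the trees of
  a sample.\<close>

lemma vlist_forest:
  assumes "list_all2 (\<lambda>x v. node_val (l x) (X x) (k x) v) xs vs"
  obtains F where "vlist vs = fval F" "roots F = map l xs" "fobs F = (\<Union>x \<in> set xs. X x)"
    "size F = sum_list (map k xs)"
proof -
  have "\<exists>F. vlist vs = fval F \<and> roots F = map l xs \<and> fobs F = (\<Union>x \<in> set xs. X x) \<and>
    size F = sum_list (map k xs)"
    using assms
  proof (induction rule: list_all2_induct)
    case Nil
    show ?case by (rule exI[of _ Empty]) simp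
  next
    case (Cons x xs v vs)
    obtain G where G: "vlist vs = fval G" "roots G = map l xs" "fobs G = (\<Union>x \<in> set xs. X x)"
      "size G = sum_list (map k xs)"
      using Cons.IH by blast
    obtain F where F: "v = VPair (VSym (l x)) (fval F)"
      "X x = insert (l x, count_list (roots F)) (fobs F)" "k x = Suc (size F)"
      using Cons.hyps unfolding node_val_def by blast
    show ?case
      by (rule exI[of _ "Branch (l x) F G"]) (simp add: F G)
  qed
  then show thesis using that by blast
qed

lemma count_list_map_distinct:
  assumes "distinct xs"
  shows "count_list (map f xs) b = card {x \<in> set xs. f x = b}"
  using assms
proof (induction xs)
  case (Cons x xs)
  have "{y \<in> set (x # xs). f y = b} =
    (if f x = b then insert x {y \<in> set xs. f y = b} else {y \<in> set xs. f y = b})"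
    by auto
  with Cons show ?case by auto
qed simp

text \<open>The order in which children are listed is lost in \<open>count_list\<close>, unions and
  sums, so every encoding yields the same observations and the same size.\<close>

lemma enc_node_val:
  assumes "enc_node t n v" and t: "t \<in> trees \<Sigma>"
  shows "node_val (tlab t n) ((\<lambda>m. (tlab t m, ch t m)) ` desc t n) (card (desc t n)) v"
  using assms(1)
proof (induction rule: enc_node.induct)
  case (1 n v)
  let ?l = "\<lambda>m. (tlab t m, ch t m)"
  obtain xs vs where xs: "distinct xs" "set xs = {m. (n, m) \<in> tchild t}" "v = vlist vs"
    "list_all2 (\<lambda>m v. enc_node t m v \<and>
       node_val (tlab t m) (?l ` desc t m) (card (desc t m)) v) xs vs"
    using 1 unfolding enc_set_def by blast
  then have nv: "list_all2 (\<lambda>m. node_val (tlab t m) (?l ` desc t m) (card (desc t m))) xs vs"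
    by (elim list_all2_mono) blast
  obtain F where F: "vlist vs = fval F" "roots F = map (tlab t) xs"
    "fobs F = (\<Union>m \<in> set xs. ?l ` desc t m)"
    "size F = sum_list (map (\<lambda>m. card (desc t m)) xs)"
    using vlist_forest[OF nv] by blast
  have "count_list (roots F) b = ch t n b" for b
  proof -
    have "{m \<in> set xs. tlab t m = b} = {m \<in> tnodes t. (n, m) \<in> tchild t \<and> tlab t m = b}"
      using treesD(4)[OF t] xs(2) by auto
    then show ?thesis
      unfolding F(2) count_list_map_distinct[OF xs(1)] ch_def by simp
  qed
  then have "count_list (roots F) = ch t n" ..
  moreover have "?l ` desc t n = insert (?l n) (fobs F)"
    unfolding F(3) xs(2) by (subst desc_unfold) (simp add: image_UN)
  moreover have "card (desc t n) = Suc (size F)"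
    unfolding F(4) sum_list_distinct_conv_sum_set[OF xs(1)] xs(2) by (rule card_desc[OF t])
  ultimately show ?case
    unfolding node_val_def xs(3) F(1) by auto
qed

text \<open>\<open>as\<close> and \<open>F\<close> depend on the orders chosen by the encoding, but
  the set of root labels, the observations and the size do not.\<close>

lemma enc_input_forest:
  assumes "enc_input (MS_rep \<Sigma>) \<Sigma> D v" "sample (MS \<Sigma>) D"
  obtains as F where "v = VPair (vlist (map VSym as)) (fval F)" "distinct as" "set as = \<Sigma>"
    "set (roots F) = (\<lambda>t. tlab t (troot t)) ` D" "fobs F = observations D"
    "length as + size F = input_size (MS_rep \<Sigma>) \<Sigma> D" "F \<noteq> Empty"
proof -
  have D: "D \<subseteq> trees \<Sigma>" "D \<noteq> {}"
    using assms(2) by (auto simp: sample_def MS_def)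
  obtain u w where v: "v = VPair u w" "enc_set enc_sym \<Sigma> u" "enc_set enc_tree D w"
    using assms(1) unfolding enc_input_def MS_rep_def by auto
  obtain as us where as: "distinct as" "set as = \<Sigma>" "list_all2 enc_sym as us" "u = vlist us"
    using v(2) unfolding enc_set_def by blast
  have "us = map VSym as"
    using as(3) unfolding enc_sym_def by (simp add: list_all2_conv_all_nth list_eq_iff_nth_eq)
  obtain ts vs where ts: "distinct ts" "set ts = D" "list_all2 enc_tree ts vs" "w = vlist vs"
    using v(3) unfolding enc_set_def by blast
  let ?X = "\<lambda>t. (\<lambda>m. (tlab t m, ch t m)) ` tnodes t"
  have "list_all2 (\<lambda>t. node_val (tlab t (troot t)) (?X t) (tree_size t)) ts vs"
    using ts(3)
  proof (rule list.rel_mono_strong)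
    fix t v
    assume "t \<in> set ts" "enc_tree t v"
    then show "node_val (tlab t (troot t)) (?X t) (tree_size t) v"
      using enc_node_val[of t "troot t" v \<Sigma>] D(1) ts(2)
      by (auto simp: enc_tree_def tree_size_def desc_root)
  qed
  then obtain F where F: "vlist vs = fval F" "roots F = map (\<lambda>t. tlab t (troot t)) ts"
    "fobs F = (\<Union>t \<in> set ts. ?X t)" "size F = sum_list (map tree_size ts)"
    by (rule vlist_forest)
  have "fobs F = observations D"
    unfolding F(3) ts(2) observations_def by auto
  moreover have "length as + size F = input_size (MS_rep \<Sigma>) \<Sigma> D"
    using as(1,2) ts(1,2) F(4)
    by (simp add: input_size_def sample_size_def MS_rep_def sum_list_distinct_conv_sum_set
        distinct_card[symmetric])
  moreover have "F \<noteq> Empty" using F(2) D(2) ts(2) by auto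
  ultimately show thesis
    using that[of as F] v(1) as(1,2,4) \<open>us = map VSym as\<close> ts(2,4) F(1,2) by simp
qed


section \<open>Correctness of the learned schema\<close>

lemma least_mult_upper: "k \<in> K \<Longrightarrow> k \<in> mult_set (least_mult K)"
proof -
  assume k: "k \<in> K"
  consider "k = 0" | "k = 1" | "2 \<le> k" by linarith
  then show "k \<in> mult_set (least_mult K)"
    using k by cases (fastforce simp: least_mult_def passes_def)+
qed

text \<open>Each test passed by \<open>K\<close> yields an element of \<open>mult_set M\<close>, and
  for each of the five \<open>M\<close> these elements settle the inclusion. Nonemptiness matters:
  for empty \<open>K\<close> the value is \<open>Zero\<close>, yet \<open>mult_set Zero\<close> is
  not contained in \<open>mult_set One\<close>.\<close>

lemma least_mult_least:
  assumes "K \<noteq> {}" "K \<subseteq> mult_set M"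
  shows "mult_set (least_mult K) \<subseteq> mult_set M"
proof -
  define P where "P m \<longleftrightarrow> (\<exists>k \<in> K. passes m k)" for m
  obtain k where "k \<in> K" using assms(1) by blast
  then have "P 0 \<or> P 1"
    by (cases "k = 0") (force simp: P_def passes_def)+
  moreover have "P 0 \<Longrightarrow> 0 \<in> mult_set M" "P 1 \<Longrightarrow> \<exists>x \<in> mult_set M. 1 \<le> x"
    "P 2 \<Longrightarrow> \<exists>x \<in> mult_set M. 2 \<le> x"
    using assms(2) by (auto simp: P_def passes_def)
  ultimately show ?thesis
    unfolding least_mult_def P_def[symmetric] by (cases M) auto
qed

text \<open>Only three tests enter \<open>least_mult\<close>, so one witness for each passed test
  suffices. This keeps characteristic samples small.\<close>

lemma least_mult_eq:
  assumes "K' \<subseteq> K" "\<And>m. m \<le> 2 \<Longrightarrow> \<exists>k \<in> K. passes m k \<Longrightarrow> \<exists>k \<in> K'. passes m k"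
  shows "least_mult K' = least_mult K"
proof -
  have "(\<exists>k \<in> K'. passes m k) \<longleftrightarrow> (\<exists>k \<in> K. passes m k)" if "m \<le> 2" for m
    using assms that by blast
  from this[of 0] this[of 1] this[of 2] show ?thesis
    unfolding least_mult_def by simp
qed

section \<open>The learned schema and its language\<close>

definition learned :: "'a list \<Rightarrow> 'a \<Rightarrow> ('a \<times> 'a uword) set \<Rightarrow> 'a schema" where
  "learned as r X = \<lparr>sroot = r, srule = restrict (learned_rule as X) (set as)\<rparr>"

lemma learned_schema: "r \<in> set as \<Longrightarrow> distinct as \<Longrightarrow> learned as r X \<in> schemas (set as)"
  unfolding schemas_def learned_def mexprs_def learned_rule_def
  by (auto simp: comp_def)

lemma learned_rule_lang:
  "w \<in> mexpr_lang (learned_rule as X a) \<longleftrightarrow>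
     (\<forall>b \<in> set as. w b \<in> mult_set (least_mult (counts X a b))) \<and> (\<forall>b. b \<notin> set as \<longrightarrow> w b = 0)"
  unfolding mexpr_lang_def learned_rule_def by (auto simp: image_image)

lemma ch_outside:
  assumes "t \<in> trees \<Sigma>" "b \<notin> \<Sigma>"
  shows "ch t n b = 0"
proof -
  have "{m \<in> tnodes t. (n, m) \<in> tchild t \<and> tlab t m = b} = {}"
    using treesD(3)[OF assms(1)] assms(2) by auto
  then show ?thesis by (simp only: ch_def card.empty)
qed

lemma learned_lang:
  assumes "t \<in> trees (set as)"
  shows "t \<in> schema_lang (set as) (learned as r X) \<longleftrightarrow>
    tlab t (troot t) = r \<and>
    (\<forall>n \<in> tnodes t. \<forall>b \<in> set as. ch t n b \<in> mult_set (least_mult (counts X (tlab t n) b)))"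
proof -
  have "tlab t n \<in> set as" if "n \<in> tnodes t" for n
    using treesD(3)[OF assms] that by auto
  then show ?thesis
    using assms ch_outside[OF assms]
    by (simp add: schema_lang_def learned_def learned_rule_lang)
qed

lemma learned_consistent:
  assumes "D \<subseteq> trees (set as)" "\<And>t. t \<in> D \<Longrightarrow> tlab t (troot t) = r"
  shows "D \<subseteq> schema_lang (set as) (learned as r (observations D))"
proof
  fix t
  assume t: "t \<in> D"
  have "ch t n b \<in> counts (observations D) (tlab t n) b" if "n \<in> tnodes t" for n b
    using t that by (auto simp: counts_def observations_def)
  then show "t \<in> schema_lang (set as) (learned as r (observations D))"
    using t assms by (subst learned_lang) (auto intro: least_mult_upper)
qed

lemma enc_learned:
  assumes "distinct as"
  shows "enc_schema (set as) (learned as r X)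
    (VPair (VSym r) (vlist (map (\<lambda>a. VPair (VSym a) (enc_mexpr (learned_rule as X a))) as)))"
  using assms unfolding enc_schema_def enc_set_def learned_def
  by (intro exI[of _ "vlist (map (\<lambda>a. VPair (VSym a) (enc_mexpr (learned_rule as X a))) as)"]
      conjI exI[of _ as] exI[of _ "map (\<lambda>a. VPair (VSym a) (enc_mexpr (learned_rule as X a))) as"])
    (simp_all add: list_all2_conv_all_nth)

lemma ch_pos:
  assumes "t \<in> trees \<Sigma>" "(n, m) \<in> tchild t"
  shows "ch t n (tlab t m) \<noteq> 0"
proof -
  have "m \<in> {k \<in> tnodes t. (n, k) \<in> tchild t \<and> tlab t k = tlab t m}"
    using treesD(4)[OF assms(1)] assms(2) by auto
  then show ?thesis
    using treesD(1)[OF assms(1)] by (auto simp: ch_def)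
qed

lemma ch_posD:
  assumes "ch t n b \<noteq> 0"
  obtains m where "m \<in> tnodes t" "(n, m) \<in> tchild t" "tlab t m = b"
proof -
  have "{m \<in> tnodes t. (n, m) \<in> tchild t \<and> tlab t m = b} \<noteq> {}"
    using assms unfolding ch_def by (metis card.empty)
  then show thesis using that by blast
qed

lemma schema_langD:
  assumes "t \<in> schema_lang \<Sigma> c" "n \<in> tnodes t"
  shows "(b, M) \<in> set (srule c (tlab t n)) \<Longrightarrow> ch t n b \<in> mult_set M"
    "b \<notin> fst ` set (srule c (tlab t n)) \<Longrightarrow> ch t n b = 0"
  using assms unfolding schema_lang_def mexpr_lang_def by fastforce+

lemma counts_nonempty: "a \<in> fst ` X \<Longrightarrow> counts X a b \<noteq> {}"
  unfolding counts_def by force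

text \<open>On observed labels the learned multiplicities are least and thus lie within those of
  \<open>c\<close>. On other labels the default \<open>Zero\<close> might violate \<open>c\<close>,
  but \<open>occurs\<close> shows that no tree of the learned schema contains such labels.\<close>

lemma learned_sub:
  assumes D: "D \<subseteq> schema_lang (set as) c" "D \<noteq> {}"
  shows "schema_lang (set as) (learned as (sroot c) (observations D)) \<subseteq> schema_lang (set as) c"
proof
  let ?X = "observations D"
  fix t
  assume tl: "t \<in> schema_lang (set as) (learned as (sroot c) ?X)"
  then have t: "t \<in> trees (set as)" by (simp add: schema_lang_def)
  have r: "tlab t (troot t) = sroot c"
    and chs: "\<And>n b. n \<in> tnodes t \<Longrightarrow> b \<in> set as \<Longrightarrow>
      ch t n b \<in> mult_set (least_mult (counts ?X (tlab t n) b))"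
    using tl learned_lang[OF t] by auto
  have lab: "tlab t n \<in> set as" if "n \<in> tnodes t" for n
    using treesD(3)[OF t] that by auto
  have occurs: "tlab t n \<in> fst ` ?X" if "n \<in> tnodes t" for n
  proof -
    \<comment> \<open>Induction along the path from the root: below a label occurring in
      \<open>D\<close>, a child has a nonzero count, so its learned multiplicity is not confined to
      \<open>0\<close>, and \<open>D\<close> must contain such a child.\<close>
    have "(troot t, n) \<in> (tchild t)\<^sup>*"
      using desc_root[OF t] that by (auto simp: desc_def)
    then show ?thesis
    proof (induction rule: rtrancl_induct)
      case base
      obtain s where s: "s \<in> D" using D(2) by blast
      then have "s \<in> trees (set as)" "tlab s (troot s) = sroot c"
        using D(1) by (auto simp: schema_lang_def)
      then have "(sroot c, ch s (troot s)) \<in> ?X"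
        using s treesD(2) by (force simp: observations_def)
      then show ?case using r by force
    next
      case (step m n)
      have mn: "m \<in> tnodes t" "n \<in> tnodes t"
        using step(2) treesD(4)[OF t] by auto
      have "ch t m (tlab t n) \<noteq> 0"
        using ch_pos[OF t step(2)] .
      then have "ch t m (tlab t n) \<notin> mult_set Zero" by simp
      then have "\<not> counts ?X (tlab t m) (tlab t n) \<subseteq> mult_set Zero"
        using chs[OF mn(1) lab[OF mn(2)]]
          least_mult_least[OF counts_nonempty[OF step(3)], of "tlab t n" Zero] by blast
      then obtain s k where s: "s \<in> D" "k \<in> tnodes s" "ch s k (tlab t n) \<noteq> 0"
        by (auto simp: counts_def observations_def)
      from s(3) obtain l where "l \<in> tnodes s" "tlab s l = tlab t n"
        by (rule ch_posD)
      moreover from this have "(tlab s l, ch s l) \<in> ?X"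
        using s(1) unfolding observations_def by blast
      ultimately show ?case by (metis fst_conv imageI)
    qed
  qed
  have "ch t n \<in> mexpr_lang (srule c (tlab t n))" if n: "n \<in> tnodes t" for n
  proof -
    \<comment> \<open>\<open>chs\<close> covers only symbols of the alphabet. Other symbols have
      count \<open>0\<close>, hence the disjunction in the second premise.\<close>
    have hull: "ch t n b \<in> mult_set M"
      if "counts ?X (tlab t n) b \<subseteq> mult_set M" "0 \<in> mult_set M \<or> b \<in> set as" for b M
      using that least_mult_least[OF counts_nonempty[OF occurs[OF n]] that(1)] chs[OF n]
        ch_outside[OF t] by (cases "b \<in> set as") auto
    have "ch t n b \<in> mult_set M" if b: "(b, M) \<in> set (srule c (tlab t n))" for b M
    proof (rule hull)
      show c: "counts ?X (tlab t n) b \<subseteq> mult_set M"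
        using D(1) b schema_langD(1) by (fastforce simp: counts_def observations_def)
      \<comment> \<open>Outside the alphabet all observed counts are \<open>0\<close>, and there is
        at least one, so \<open>M\<close> must allow \<open>0\<close>.\<close>
      show "0 \<in> mult_set M \<or> b \<in> set as"
      proof (cases "b \<in> set as")
        case False
        then have "counts ?X (tlab t n) b \<subseteq> {0}"
          using D(1) ch_outside[OF _ False]
          by (fastforce simp: counts_def observations_def schema_lang_def)
        with c counts_nonempty[OF occurs[OF n], of b] show ?thesis by auto
      qed simp
    qed
    moreover have "ch t n b = 0" if b: "b \<notin> fst ` set (srule c (tlab t n))" for b
    proof -
      have "counts ?X (tlab t n) b \<subseteq> mult_set Zero"
        using D(1) b schema_langD(2) by (fastforce simp: counts_def observations_def)
      then show ?thesis using hull by fastforce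
    qed
    ultimately show ?thesis unfolding mexpr_lang_def by auto
  qed
  then show "t \<in> schema_lang (set as) c"
    using t r by (simp add: schema_lang_def)
qed


section \<open>Characteristic samples\<close>

lemma card_insert_None: "finite A \<Longrightarrow> card (insert None (Some ` A)) = Suc (card A)"
  by (simp add: card_image)

lemma characteristic_sample:
  assumes "finite \<Sigma>" "c \<in> schemas \<Sigma>" "schema_lang \<Sigma> c \<noteq> {}"
  obtains CS where "finite CS" "CS \<noteq> {}" "CS \<subseteq> schema_lang \<Sigma> c"
    "card CS \<le> 4 * schema_size \<Sigma> c"
    "\<forall>D a b. CS \<subseteq> D \<longrightarrow> D \<subseteq> schema_lang \<Sigma> c \<longrightarrow>
       least_mult (counts (observations D) a b) =
       least_mult (counts (observations (schema_lang \<Sigma> c)) a b)"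
proof -
  let ?L = "schema_lang \<Sigma> c"
  \<comment> \<open>Requests to a tree: \<open>None\<close> asks for nothing,
    \<open>Some (a, None)\<close> for a node labelled \<open>a\<close>, and
    \<open>Some (a, Some (b, m))\<close> for such a node whose number of \<open>b\<close>-children
    passes test \<open>m\<close>.\<close>
  define Q where "Q x t \<longleftrightarrow> (case x of None \<Rightarrow> True | Some (a, None) \<Rightarrow> a \<in> tlab t ` tnodes t
    | Some (a, Some (b, m)) \<Rightarrow> \<exists>n \<in> tnodes t. tlab t n = a \<and> passes m (ch t n b))"
    for x :: "('a \<times> ('a \<times> nat) option) option" and t :: "'a tree"
  define W where "W = insert None (Some ` (SIGMA a:\<Sigma>. insert None
    (Some ` (fst ` set (srule c a) \<times> {..2 :: nat}))))"
  define wit where "wit x = (SOME t. t \<in> ?L \<and> Q x t)" for x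
  \<comment> \<open>\<open>wit\<close> is meaningful only for requests that some tree of the
    language meets; the others are dropped.\<close>
  define CS where "CS = wit ` {x \<in> W. \<exists>t \<in> ?L. Q x t}"
  have wit: "wit x \<in> ?L \<and> Q x (wit x)" if "\<exists>t \<in> ?L. Q x t" for x
    unfolding wit_def using someI_ex[of "\<lambda>t. t \<in> ?L \<and> Q x t"] that by blast
  have finW: "finite W"
    unfolding W_def using assms(1) by auto
  \<comment> \<open>\<open>{..2}\<close> holds three tests, so a label with \<open>k\<close> factors
    contributes at most \<open>1 + 3 * k\<close> requests.\<close>
  have cardW: "card W \<le> 4 * schema_size \<Sigma> c"
  proof -
    let ?A = "\<lambda>a. insert None (Some ` (fst ` set (srule c a) \<times> {..2 :: nat}))"
    have A: "card (?A a) \<le> 4 * (1 + length (srule c a))" for a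
    proof -
      have "card (?A a) = Suc (card (fst ` set (srule c a) \<times> {..2 :: nat}))"
        by (rule card_insert_None) simp
      also have "card (fst ` set (srule c a) \<times> {..2 :: nat}) \<le> length (srule c a) * 3"
        unfolding card_cartesian_product
        by (rule mult_le_mono) (auto intro: order.trans[OF card_image_le] card_length)
      finally show ?thesis by simp
    qed
    have "card W = Suc (card (SIGMA a:\<Sigma>. ?A a))"
      unfolding W_def using assms(1) by (intro card_insert_None) auto
    also have "card (SIGMA a:\<Sigma>. ?A a) = (\<Sum>a \<in> \<Sigma>. card (?A a))"
      using assms(1) by (intro card_SigmaI) auto
    also have "\<dots> \<le> (\<Sum>a \<in> \<Sigma>. 4 * (1 + length (srule c a)))"
      by (rule sum_mono) (rule A)
    finally show ?thesis
      unfolding schema_size_def sum_distrib_left[symmetric] by simp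
  qed
  show thesis
  proof
    show "finite CS" using finW by (simp add: CS_def)
    show "CS \<subseteq> ?L" using wit by (auto simp: CS_def)
    have "card CS \<le> card W"
      unfolding CS_def using finW
      by (intro order.trans[OF card_image_le card_mono]) auto
    with cardW show "card CS \<le> 4 * schema_size \<Sigma> c" by simp
    \<comment> \<open>The request \<open>None\<close> is there because a sample must not be
      empty.\<close>
    have "wit None \<in> CS"
      unfolding CS_def by (rule imageI) (use assms(3) in \<open>auto simp: W_def Q_def\<close>)
    then show "CS \<noteq> {}" by blast
    show "\<forall>D a b. CS \<subseteq> D \<longrightarrow> D \<subseteq> ?L \<longrightarrow>
      least_mult (counts (observations D) a b) = least_mult (counts (observations ?L) a b)"
    proof (intro allI impI)
      fix D a b
      assume D: "CS \<subseteq> D" "D \<subseteq> ?L"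
      have found: "\<exists>t \<in> D. Q x t" if "x \<in> W" "\<exists>t \<in> ?L. Q x t" for x
        using that wit[of x] D(1) by (auto simp: CS_def)
      show "least_mult (counts (observations D) a b) = least_mult (counts (observations ?L) a b)"
      proof (rule least_mult_eq)
        show "counts (observations D) a b \<subseteq> counts (observations ?L) a b"
          using D(2) by (auto simp: counts_def observations_def)
      next
        fix m :: nat
        assume m: "m \<le> 2" and "\<exists>k \<in> counts (observations ?L) a b. passes m k"
        then obtain t n where t: "t \<in> ?L" "n \<in> tnodes t" "tlab t n = a" "passes m (ch t n b)"
          by (auto simp: counts_def observations_def)
        then have a: "a \<in> \<Sigma>"
          using treesD(3)[of t \<Sigma>] by (auto simp: schema_lang_def)
        show "\<exists>k \<in> counts (observations D) a b. passes m k"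
        proof (cases "b \<in> fst ` set (srule c a)")
          case True
          then have "Some (a, Some (b, m)) \<in> W"
            unfolding W_def using a m by (intro insertI2 imageI SigmaI) auto
          moreover have "Q (Some (a, Some (b, m))) t"
            using t by (auto simp: Q_def)
          ultimately obtain s where "s \<in> D" "Q (Some (a, Some (b, m))) s"
            using found t(1) by blast
          then show ?thesis
            by (auto simp: Q_def counts_def observations_def)
        next
          case False
          \<comment> \<open>A symbol outside the rule has count \<open>0\<close> at every node
            labelled \<open>a\<close> in the language, so any such node in \<open>D\<close> passes
            the same tests as \<open>n\<close>.\<close>
          have "Some (a, None) \<in> W"
            unfolding W_def using a by (intro insertI2 imageI SigmaI insertI1)
          moreover have "Q (Some (a, None)) t"
            using t by (auto simp: Q_def)
          ultimately obtain s k where s: "s \<in> D" "k \<in> tnodes s" "tlab s k = a"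
            using found t(1) by (fastforce simp: Q_def)
          have "ch s k b = 0"
            using schema_langD(2)[of s \<Sigma> c k b] False D(2) s by auto
          moreover have "ch t n b = 0"
            using schema_langD(2)[of t \<Sigma> c n b] False t by auto
          ultimately have "passes m (ch s k b)" using t(4) by simp
          then show ?thesis
            using s by (auto simp: counts_def observations_def)
        qed
      qed
    qed
  qed
qed

text \<open>The learned schema depends on the observations only through \<open>least_mult\<close>,
  so learning from \<open>D\<close> and from the whole language gives the same schema. The latter
  contains the language by \<open>learned_consistent\<close>; the other inclusion is
  \<open>learned_sub\<close>.\<close>

lemma learned_equivalent:
  assumes D: "D \<subseteq> schema_lang (set as) c" "D \<noteq> {}"
    and eq: "\<And>a b. least_mult (counts (observations D) a b) =
       least_mult (counts (observations (schema_lang (set as) c)) a b)"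
  shows "schema_lang (set as) (learned as (sroot c) (observations D)) = schema_lang (set as) c"
proof
  show "schema_lang (set as) (learned as (sroot c) (observations D)) \<subseteq> schema_lang (set as) c"
    using D by (rule learned_sub)
  let ?L = "schema_lang (set as) c"
  have "?L \<subseteq> schema_lang (set as) (learned as (sroot c) (observations ?L))"
    by (rule learned_consistent) (auto simp: schema_lang_def)
  also have "\<dots> = schema_lang (set as) (learned as (sroot c) (observations D))"
    unfolding learned_def learned_rule_def eq ..
  finally show "?L \<subseteq> \<dots>" .
qed


section \<open>Learnability\<close>

lemma learner_result:
  assumes "enc_input (MS_rep \<Sigma>) \<Sigma> D v" "sample (MS \<Sigma>) D"
  obtains as r t where "distinct as" "set as = \<Sigma>" "runs learner v r t"
    "t \<le> 600 * (input_size (MS_rep \<Sigma>) \<Sigma> D + 1) ^ 4"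
    "\<And>b. (\<lambda>t. tlab t (troot t)) ` D = {b} \<Longrightarrow> enc_schema \<Sigma> (learned as b (observations D)) r"
    "(\<nexists>b. (\<lambda>t. tlab t (troot t)) ` D = {b}) \<Longrightarrow> r = null"
proof -
  obtain as F where F: "v = VPair (vlist (map VSym as)) (fval F)" "distinct as" "set as = \<Sigma>"
    "set (roots F) = (\<lambda>t. tlab t (troot t)) ` D" "fobs F = observations D"
    "length as + size F = input_size (MS_rep \<Sigma>) \<Sigma> D" "F \<noteq> Empty"
    using enc_input_forest[OF assms] .
  obtain t where t: "t \<le> 600 * (input_size (MS_rep \<Sigma>) \<Sigma> D + 1) ^ 4"
    "runs learner v (learned_val as F) t"
    using runs_learner[OF F(7), of as] unfolding F(1,6) by blast
  have ne: "roots F \<noteq> []" using F(7) by (cases F) auto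
  show thesis
  proof
    show "enc_schema \<Sigma> (learned as b (observations D)) (learned_val as F)"
      if "(\<lambda>t. tlab t (troot t)) ` D = {b}" for b
    proof -
      have "set (roots F) = {b}" using that F(4) by simp
      moreover from this have "hd (roots F) = b" using ne hd_in_set by blast
      ultimately show ?thesis
        using enc_learned[OF F(2)] unfolding learned_val_def F(3,5) by simp
    qed
    show "learned_val as F = null" if "\<nexists>b. (\<lambda>t. tlab t (troot t)) ` D = {b}"
    proof -
      have "\<not> (\<forall>a \<in> set (roots F). a = hd (roots F))"
      proof
        assume "\<forall>a \<in> set (roots F). a = hd (roots F)"
        then have "set (roots F) = {hd (roots F)}" using ne hd_in_set by blast
        with that F(4) show False by metis
      qed
      then show ?thesis unfolding learned_val_def by simp
    qed
  qed (use F t in auto)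
qed

text \<open>By determinism, what is known of the run found in \<open>learner_result\<close> holds
  for every run, as soundness and completeness require.\<close>

lemma learner_result_unique:
  assumes "enc_input (MS_rep \<Sigma>) \<Sigma> D v" "sample (MS \<Sigma>) D" "runs learner v r t"
  obtains as where "distinct as" "set as = \<Sigma>"
    "\<And>b. (\<lambda>t. tlab t (troot t)) ` D = {b} \<Longrightarrow> enc_schema \<Sigma> (learned as b (observations D)) r"
    "(\<nexists>b. (\<lambda>t. tlab t (troot t)) ` D = {b}) \<Longrightarrow> r = null"
proof -
  obtain as r' t' where as: "distinct as" "set as = \<Sigma>" "runs learner v r' t'"
    "\<And>b. (\<lambda>t. tlab t (troot t)) ` D = {b} \<Longrightarrow> enc_schema \<Sigma> (learned as b (observations D)) r'"
    "(\<nexists>b. (\<lambda>t. tlab t (troot t)) ` D = {b}) \<Longrightarrow> r' = null"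
    using assms(1,2) by (rule learner_result) blast
  moreover have "r' = r"
    using as(3) assms(3) unfolding runs_def using eval_deterministic(1) by blast
  ultimately show thesis using that by blast
qed

lemma sample_MS: "sample (MS \<Sigma>) D \<longleftrightarrow> finite D \<and> D \<noteq> {} \<and> D \<subseteq> trees \<Sigma>"
  by (simp add: sample_def MS_def)

lemma consistent_MS: "consistent (MS \<Sigma>) D c \<longleftrightarrow> D \<subseteq> schema_lang \<Sigma> c"
  by (simp add: consistent_def MS_def)

lemma MS_simps: "language (MS \<Sigma>) = schema_lang \<Sigma>" "concepts (MS \<Sigma>) = schemas \<Sigma>"
  by (simp_all add: MS_def)

lemma consistent_root:
  assumes "D \<subseteq> schema_lang \<Sigma> c" "D \<noteq> {}"
  shows "(\<lambda>t. tlab t (troot t)) ` D = {sroot c}"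
  using assms by (force simp: schema_lang_def)

section \<open>Running time, soundness and completeness of the learner\<close>

lemma learner_polynomial_time: "polynomial_time MS MS_rep learner"
  unfolding polynomial_time_def
proof (intro exI[of _ "[:600:] * [:1, 1:] ^ 4"] allI impI)
  fix \<Sigma> :: "'a set" and D v
  assume "finite \<Sigma> \<and> sample (MS \<Sigma>) D \<and> enc_input (MS_rep \<Sigma>) \<Sigma> D v"
  then obtain r t where "runs learner v r t" "t \<le> 600 * (input_size (MS_rep \<Sigma>) \<Sigma> D + 1) ^ 4"
    using learner_result by metis
  then show "\<exists>r t. runs learner v r t \<and>
    t \<le> poly ([:600:] * [:1, 1:] ^ 4) (input_size (MS_rep \<Sigma>) \<Sigma> D)"
    by (auto simp: poly_power)
qed

lemma learner_sound: "sound MS MS_rep learner"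
  unfolding sound_def
proof (intro allI impI)
  fix \<Sigma> :: "'a set" and D v r t
  assume *: "finite \<Sigma> \<and> sample (MS \<Sigma>) D \<and> enc_input (MS_rep \<Sigma>) \<Sigma> D v \<and> runs learner v r t"
  then have D: "D \<noteq> {}" "D \<subseteq> trees \<Sigma>" by (auto simp: sample_MS)
  obtain as where as: "distinct as" "set as = \<Sigma>"
    and r: "\<And>b. (\<lambda>t. tlab t (troot t)) ` D = {b} \<Longrightarrow> enc_schema \<Sigma> (learned as b (observations D)) r"
      "(\<nexists>b. (\<lambda>t. tlab t (troot t)) ` D = {b}) \<Longrightarrow> r = null"
    using * learner_result_unique[of \<Sigma> D v r t] by blast
  show "(\<exists>c \<in> concepts (MS \<Sigma>). enc_concept (MS_rep \<Sigma>) c r \<and> consistent (MS \<Sigma>) D c) \<or>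
    r = null \<and> \<not> (\<exists>c \<in> concepts (MS \<Sigma>). consistent (MS \<Sigma>) D c)"
  proof (cases "\<exists>b. (\<lambda>t. tlab t (troot t)) ` D = {b}")
    case True
    then obtain b where b: "(\<lambda>t. tlab t (troot t)) ` D = {b}" by blast
    then have lab: "\<And>t. t \<in> D \<Longrightarrow> tlab t (troot t) = b" by blast
    obtain t where t: "t \<in> D" using D(1) by blast
    then have "b \<in> \<Sigma>"
      using D(2) treesD(2,3)[of t \<Sigma>] lab[OF t] by auto
    then have "learned as b (observations D) \<in> schemas \<Sigma>"
      using learned_schema as by metis
    moreover have "D \<subseteq> schema_lang \<Sigma> (learned as b (observations D))"
      using learned_consistent[of D as b] D(2) lab as(2) by simp
    ultimately show ?thesis
      using r(1)[OF b] by (auto simp: consistent_MS MS_simps MS_rep_def)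
  next
    case False
    then show ?thesis
      using r(2) consistent_root D(1) by (metis consistent_MS)
  qed
qed

lemma learner_complete: "complete MS MS_rep learner"
  unfolding complete_def
\<comment> \<open>The polynomial is \<open>1 + 4 * n\<close>: the linear part bounds the
  characteristic sample, the \<open>1\<close> a one-tree sample for an empty language.\<close>
proof (intro exI[of _ "[:1, 4:]"] allI impI ballI)
  fix \<Sigma> :: "'a set" and c
  assume fin: "finite \<Sigma>" and "c \<in> concepts (MS \<Sigma>)"
  then have c: "c \<in> schemas \<Sigma>" by (simp add: MS_def)
  show "\<exists>CS. sample (MS \<Sigma>) CS \<and> card CS \<le> poly [:1, 4:] (concept_size (MS_rep \<Sigma>) c) \<and>
       (language (MS \<Sigma>) c \<noteq> {} \<longrightarrow> consistent (MS \<Sigma>) CS c) \<and>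
       (\<forall>D v r t. sample (MS \<Sigma>) D \<and> CS \<subseteq> D \<and> consistent (MS \<Sigma>) D c \<and>
          enc_input (MS_rep \<Sigma>) \<Sigma> D v \<and> runs learner v r t \<longrightarrow>
          (\<exists>c' \<in> concepts (MS \<Sigma>). enc_concept (MS_rep \<Sigma>) c' r \<and>
             language (MS \<Sigma>) c' = language (MS \<Sigma>) c))"
  proof (cases "schema_lang \<Sigma> c = {}")
    case True
    \<comment> \<open>With an empty language no sample is consistent with \<open>c\<close>, so any
      tree may form \<open>CS\<close>; a single node is the simplest.\<close>
    define t0 :: "'a tree" where
      "t0 = \<lparr>tnodes = {0}, troot = 0, tlab = restrict (\<lambda>_. sroot c) {0}, tchild = {}\<rparr>"
    have "t0 \<in> trees \<Sigma>"
      using c by (auto simp: t0_def trees_def schemas_def acyclic_def)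
    then show ?thesis
      using True by (intro exI[of _ "{t0}"]) (auto simp: sample_MS consistent_MS MS_simps)
  next
    case False
    obtain CS where CS: "finite CS" "CS \<noteq> {}" "CS \<subseteq> schema_lang \<Sigma> c"
      "card CS \<le> 4 * schema_size \<Sigma> c"
      "\<forall>D a b. CS \<subseteq> D \<longrightarrow> D \<subseteq> schema_lang \<Sigma> c \<longrightarrow>
         least_mult (counts (observations D) a b) =
         least_mult (counts (observations (schema_lang \<Sigma> c)) a b)"
      using characteristic_sample[OF fin c False] .
    show ?thesis
    proof (intro exI[of _ CS] conjI allI impI)
      show "sample (MS \<Sigma>) CS"
        using CS(1-3) by (auto simp: sample_MS schema_lang_def)
      show "card CS \<le> poly [:1, 4:] (concept_size (MS_rep \<Sigma>) c)"
        using CS(4) by (simp add: MS_rep_def mult.commute)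
      show "consistent (MS \<Sigma>) CS c"
        using CS(3) by (simp add: consistent_MS)
    next
      fix D v r t
      assume *: "sample (MS \<Sigma>) D \<and> CS \<subseteq> D \<and> consistent (MS \<Sigma>) D c \<and>
        enc_input (MS_rep \<Sigma>) \<Sigma> D v \<and> runs learner v r t"
      then have D: "D \<noteq> {}" "D \<subseteq> schema_lang \<Sigma> c" "CS \<subseteq> D"
        by (auto simp: sample_MS consistent_MS)
      obtain as where as: "distinct as" "set as = \<Sigma>"
        and r: "\<And>b. (\<lambda>t. tlab t (troot t)) ` D = {b} \<Longrightarrow>
          enc_schema \<Sigma> (learned as b (observations D)) r"
        using * learner_result_unique[of \<Sigma> D v r t] by blast
      let ?S = "learned as (sroot c) (observations D)"
      have "?S \<in> schemas \<Sigma>"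
        using learned_schema[OF _ as(1)] c as(2) by (auto simp: schemas_def)
      moreover have "enc_schema \<Sigma> ?S r"
        using r consistent_root D(1,2) by blast
      moreover have "schema_lang \<Sigma> ?S = schema_lang \<Sigma> c"
        by (rule learned_equivalent[of D as c, unfolded as(2), OF D(2,1)]) (use CS(5) D in blast)
      ultimately show "\<exists>c' \<in> concepts (MS \<Sigma>). enc_concept (MS_rep \<Sigma>) c' r \<and>
        language (MS \<Sigma>) c' = language (MS \<Sigma>) c"
        by (auto simp: MS_simps MS_rep_def)
    qed
  qed
qed

theorem theorem5p1:
  "learnable_in_polynomial_time_and_data
     (MS :: 'a::linorder set \<Rightarrow> ('a tree, 'a schema) learning_setting) MS_rep"
  unfolding learnable_in_polynomial_time_and_data_def
  using learner_polynomial_time learner_sound learner_complete by blast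

end
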